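(* Let $(\mathfrak A,\delta,R)$ be a $\lambda$-weighted Rota-Baxter AssDer pair. If $\mathcal H^2_{\mathrm{R.B.AssDer}}(A,A)=0$, then every formal deformation of $(\mathfrak A,\delta,R)$ is trivial, i.e. equivalent to the deformation $(\mu'_t=\mu,\ \delta'_t=\delta,\ R'_t=R)$.
   Context: Fix a field $\mathbb{K}$ and $\lambda\in\mathbb{K}$. A $\lambda$-weighted Rota-Baxter AssDer pair $(\mathfrak A,\delta,R)$ is an associative algebra $\mathfrak A=(A,\mu)$ over $\mathbb K$ with a derivation $\delta$ and a linear map $R:A\to A$ with $\mu(Rx,Ry)=R(\mu(Rx,y)+\mu(x,Ry)+\lambda\mu(x,y))$ and $R\circ\delta=\delta\circ R$. Formal deformation. A formal ($1$-parameter) deformation of $(\mathfrak A,\delta,R)$ consists of formal power series $\mu_t=\sum_{i\ge0}\mu_it^i$, $\mu_i\in\mathrm{Hom}(A^{\otimes2},A)$, $\mu_0=\mu$; $\delta_t=\sum_{i\ge0}\delta_it^i$, $\delta_i\in\mathrm{Hom}(A,A)$, $\delta_0=\delta$; $R_t=\sum_{i\ge0}R_it^i$, $R_i\in\mathrm{Hom}(A,A)$, $R_0=R$, such that (extending $\mathbb K[[t]]$-linearly to $A[[t]]$) for all $x,y,z\in A$: $\mu_t(\mu_t(x,y),z)=\mu_t(x,\mu_t(y,z))$, $\mu_t(R_tx,R_ty)=R_t(\mu_t(R_tx,y)+\mu_t(x,R_ty)+\lambda\mu_t(x,y))$, $\delta_t(\mu_t(x,y))=\mu_t(\delta_tx,y)+\mu_t(x,\delta_ty)$.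 Equivalence. Two formal deformations $(\mu_t,\delta_t,R_t)$, $(\mu'_t,\delta'_t,R'_t)$ are equivalent if there is a formal isomorphism $\varphi_t=\sum_{i\ge0}\varphi_it^i:A[[t]]\to A[[t]]$ ($\mathbb K[[t]]$-linear, $\varphi_i\in\mathrm{Hom}(A,A)$, $\varphi_0=\mathrm{id}_A$) with $\varphi_t(\mu'_t(x,y))=\mu_t(\varphi_t(x),\varphi_t(y))$, $\varphi_t\circ\delta'_t=\delta_t\circ\varphi_t$, $\varphi_t\circ R'_t=R_t\circ\varphi_t$. Cohomology with coefficients in itself. Put $\mu_R(x,y)=\mu(x,Ry)+\mu(Rx,y)+\lambda\mu(x,y)$, $l_R(x,m)=\mu(Rx,m)-R(\mu(x,m))$, $r_R(m,x)=\mu(m,Rx)-R(\mu(m,x))$. On $C^n=\mathrm{Hom}(A^{\otimes n},A)$ let $(d_{\mathrm{Hoch}}f)(x_1,\dots,x_{n+1})=\mu(x_1,f(x_2,\dots,x_{n+1}))+\sum_{i=1}^n(-1)^if(x_1,\dots,\mu(x_i,x_{i+1}),\dots,x_{n+1})+(-1)^{n+1}\mu(f(x_1,\dots,x_n),x_{n+1})$; let $d_{\mathrm{R.Hoch}}f$ be $l_R(x_1,f(x_2,\dots,x_{n+1}))+\sum_{i=1}^n(-1)^if(x_1,\dots,\mu_R(x_i,x_{i+1}),\dots,x_{n+1})+(-1)^{n+1}r_R(f(x_1,\dots,x_n),x_{n+1})$; let $\partial f=\sum_{i=1}^nf\circ(\mathbf 1\otimes\cdots\otimes\delta\otimes\cdots\otimes\mathbf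 1)-\delta\circ f$ ($\delta$ in the $i$-th place); and $\Phi^n(f)(x_1,\dots,x_n)=f(Rx_1,\dots,Rx_n)-\sum_{k=0}^{n-1}\lambda^{n-k-1}\sum_{i_1<\cdots<i_k}R\big(f(x_1,\dots,R(x_{i_1}),\dots,R(x_{i_k}),\dots,x_n)\big)$ ($R$ applied exactly to the arguments in positions $i_1,\dots,i_k$). The cochains are $\mathfrak C^0_{\mathrm{R.B.AssDer}}(A,A)=0$, $\mathfrak C^1_{\mathrm{R.B.AssDer}}(A,A)=\mathrm{Hom}(A,A)$, $\mathfrak C^n_{\mathrm{R.B.AssDer}}(A,A)=(C^n\oplus C^{n-1})\oplus C^{n-1}$ for $n\ge2$, with $\mathfrak D_{\mathrm{R.B.AssDer}}(f)=(d_{\mathrm{Hoch}}f,-\partial f,-\Phi^1f)$ for $n=1$ and $\mathfrak D_{\mathrm{R.B.AssDer}}((f,g),h)=(d_{\mathrm{Hoch}}f,\ d_{\mathrm{Hoch}}g+(-1)^n\partial f,\ -d_{\mathrm{R.Hoch}}h-\Phi^nf)$ for $n\ge2$; $\mathcal H^n_{\mathrm{R.B.AssDer}}(A,A)$ is the $n$-th cohomology of this complex. *)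

theory Defs
  imports
    "HOL-Algebra.Elementary_Groups"
    "HOL-Computational_Algebra.Formal_Power_Series"
    "HOL-Library.Function_Algebras"
    "HOL-Library.Product_Plus"
begin

unbundle fps_syntax

section \<open>Rota-Baxter AssDer pairs\<close>

definition bilinear_map ::
    "('k::field \<Rightarrow> 'a::ab_group_add \<Rightarrow> 'a) \<Rightarrow> ('a \<Rightarrow> 'a \<Rightarrow> 'a) \<Rightarrow> bool" where
  "bilinear_map scale m \<longleftrightarrow>
     (\<forall>x. Vector_Spaces.linear scale scale (\<lambda>y. m x y)) \<and>
     (\<forall>y. Vector_Spaces.linear scale scale (\<lambda>x. m x y))"

text \<open>The algebra need be neither commutative nor unital; its underlying vector space is the
  whole type \<open>'a\<close>, with scalar multiplication \<open>scale\<close>.\<close>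

locale rota_baxter_assder_pair = vector_space scale
  for scale :: "'k::field \<Rightarrow> 'a::ab_group_add \<Rightarrow> 'a" +
  fixes w :: 'k
    and \<mu> :: "'a \<Rightarrow> 'a \<Rightarrow> 'a"
    and \<delta> :: "'a \<Rightarrow> 'a"
    and R :: "'a \<Rightarrow> 'a"
  assumes mult_bilinear: "bilinear_map scale \<mu>"
    and mult_assoc: "\<mu> (\<mu> x y) z = \<mu> x (\<mu> y z)"
    and der_linear: "Vector_Spaces.linear scale scale \<delta>"
    and derivation: "\<delta> (\<mu> x y) = \<mu> (\<delta> x) y + \<mu> x (\<delta> y)"
    and rb_linear: "Vector_Spaces.linear scale scale R"
    and rota_baxter: "\<mu> (R x) (R y) = R (\<mu> (R x) y + \<mu> x (R y) + scale w (\<mu> x y))"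
    and rb_der_commute: "R \<circ> \<delta> = \<delta> \<circ> R"


section \<open>Formal deformations\<close>

text \<open>\<open>A[[t]]\<close> is the type \<open>'a fps\<close>. A power series whose coefficients are (bi)linear maps on
  \<open>A\<close> acts on \<open>A[[t]]\<close> through its \<open>\<bbbK>[[t]]\<close>-(bi)linear extension, given by the Cauchy product
  formula; \<open>A\<close> sits in \<open>A[[t]]\<close> via \<open>fps_const\<close>.\<close>

definition ext1 :: "('a \<Rightarrow> 'a) fps \<Rightarrow> 'a::ab_group_add fps \<Rightarrow> 'a fps" where
  "ext1 f a = Abs_fps (\<lambda>n. \<Sum>i\<le>n. (f $ i) (a $ (n - i)))"

definition ext2 :: "('a \<Rightarrow> 'a \<Rightarrow> 'a) fps \<Rightarrow> 'a::ab_group_add fps \<Rightarrow> 'a fps \<Rightarrow> 'a fps" where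
  "ext2 m a b = Abs_fps (\<lambda>n. \<Sum>i\<le>n. \<Sum>j\<le>n - i. (m $ i) (a $ j) (b $ (n - i - j)))"

definition fps_scale ::
    "('k::field \<Rightarrow> 'a::ab_group_add \<Rightarrow> 'a) \<Rightarrow> 'k \<Rightarrow> 'a fps \<Rightarrow> 'a fps" where
  "fps_scale scale c a = Abs_fps (\<lambda>n. scale c (a $ n))"

definition formal_deformation ::
    "('k::field \<Rightarrow> 'a::ab_group_add \<Rightarrow> 'a) \<Rightarrow> 'k \<Rightarrow> ('a \<Rightarrow> 'a \<Rightarrow> 'a) \<Rightarrow> ('a \<Rightarrow> 'a) \<Rightarrow> ('a \<Rightarrow> 'a) \<Rightarrow>
     ('a \<Rightarrow> 'a \<Rightarrow> 'a) fps \<Rightarrow> ('a \<Rightarrow> 'a) fps \<Rightarrow> ('a \<Rightarrow> 'a) fps \<Rightarrow> bool" where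
  "formal_deformation scale w \<mu> \<delta> R \<mu>t \<delta>t Rt \<longleftrightarrow>
     (\<forall>i. bilinear_map scale (\<mu>t $ i)) \<and> \<mu>t $ 0 = \<mu> \<and>
     (\<forall>i. Vector_Spaces.linear scale scale (\<delta>t $ i)) \<and> \<delta>t $ 0 = \<delta> \<and>
     (\<forall>i. Vector_Spaces.linear scale scale (Rt $ i)) \<and> Rt $ 0 = R \<and>
     (\<forall>x y z. let X = fps_const x; Y = fps_const y; Z = fps_const z in
        ext2 \<mu>t (ext2 \<mu>t X Y) Z = ext2 \<mu>t X (ext2 \<mu>t Y Z)) \<and>
     (\<forall>x y. let X = fps_const x; Y = fps_const y in
        ext2 \<mu>t (ext1 Rt X) (ext1 Rt Y) =
          ext1 Rt (ext2 \<mu>t (ext1 Rt X) Y + ext2 \<mu>t X (ext1 Rt Y)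
                   + fps_scale scale w (ext2 \<mu>t X Y))) \<and>
     (\<forall>x y. let X = fps_const x; Y = fps_const y in
        ext1 \<delta>t (ext2 \<mu>t X Y) = ext2 \<mu>t (ext1 \<delta>t X) Y + ext2 \<mu>t X (ext1 \<delta>t Y))"

text \<open>Bijectivity of \<open>ext1 \<phi>\<close> is automatic from \<open>\<phi> $ 0 = id\<close>.\<close>

definition formal_isomorphism ::
    "('k::field \<Rightarrow> 'a::ab_group_add \<Rightarrow> 'a) \<Rightarrow> ('a \<Rightarrow> 'a) fps \<Rightarrow> bool" where
  "formal_isomorphism scale \<phi> \<longleftrightarrow>
     (\<forall>i. Vector_Spaces.linear scale scale (\<phi> $ i)) \<and> \<phi> $ 0 = id \<and> bij (ext1 \<phi>)"

definition equivalent_deformations ::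
    "('k::field \<Rightarrow> 'a::ab_group_add \<Rightarrow> 'a) \<Rightarrow>
     ('a \<Rightarrow> 'a \<Rightarrow> 'a) fps \<times> ('a \<Rightarrow> 'a) fps \<times> ('a \<Rightarrow> 'a) fps \<Rightarrow>
     ('a \<Rightarrow> 'a \<Rightarrow> 'a) fps \<times> ('a \<Rightarrow> 'a) fps \<times> ('a \<Rightarrow> 'a) fps \<Rightarrow> bool" where
  "equivalent_deformations scale = (\<lambda>(\<mu>t, \<delta>t, Rt) (\<mu>t', \<delta>t', Rt').
     \<exists>\<phi>. formal_isomorphism scale \<phi> \<and>
       (\<forall>x y. let X = fps_const x; Y = fps_const y in
          ext1 \<phi> (ext2 \<mu>t' X Y) = ext2 \<mu>t (ext1 \<phi> X) (ext1 \<phi> Y)) \<and>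
       ext1 \<phi> \<circ> ext1 \<delta>t' = ext1 \<delta>t \<circ> ext1 \<phi> \<and>
       ext1 \<phi> \<circ> ext1 Rt' = ext1 Rt \<circ> ext1 \<phi>)"


section \<open>Cohomology with coefficients in itself\<close>

text \<open>An element of \<open>Hom(A\<^sup>\<otimes>\<^sup>n, A)\<close> is an \<open>n\<close>-linear map, encoded as a function on argument lists
  that vanishes on lists of length other than \<open>n\<close>, so that equality of cochains is equality of
  functions. All operators below keep to this convention.\<close>

definition hom_tensor ::
    "('k::field \<Rightarrow> 'a::ab_group_add \<Rightarrow> 'a) \<Rightarrow> nat \<Rightarrow> ('a list \<Rightarrow> 'a) set" where
  "hom_tensor scale n =
     {f. (\<forall>xs. length xs = n \<longrightarrow>
            (\<forall>i<n. Vector_Spaces.linear scale scale (\<lambda>x. f (xs[i := x])))) \<and>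
         (\<forall>xs. length xs \<noteq> n \<longrightarrow> f xs = 0)}"

text \<open>The Hochschild differential for a product \<open>p\<close> with left action \<open>l\<close> and right action \<open>r\<close>.
  The positions \<open>i\<close> are numbered from 1, so the arguments \<open>x\<^sub>i, x\<^sub>i\<^sub>+\<^sub>1\<close> are
  \<open>xs ! (i - 1), xs ! i\<close>.\<close>

definition hochschild ::
    "('k::field \<Rightarrow> 'a::ab_group_add \<Rightarrow> 'a) \<Rightarrow> ('a \<Rightarrow> 'a \<Rightarrow> 'a) \<Rightarrow> ('a \<Rightarrow> 'a \<Rightarrow> 'a) \<Rightarrow> ('a \<Rightarrow> 'a \<Rightarrow> 'a) \<Rightarrow>
     nat \<Rightarrow> ('a list \<Rightarrow> 'a) \<Rightarrow> 'a list \<Rightarrow> 'a" where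
  "hochschild scale l p r n f = (\<lambda>xs. if length xs = n + 1 then
       l (hd xs) (f (tl xs))
       + (\<Sum>i = 1..n. scale ((-1) ^ i)
            (f (take (i - 1) xs @ [p (xs ! (i - 1)) (xs ! i)] @ drop (i + 1) xs)))
       + scale ((-1) ^ (n + 1)) (r (f (butlast xs)) (last xs))
     else 0)"

definition d_hoch ::
    "('k::field \<Rightarrow> 'a::ab_group_add \<Rightarrow> 'a) \<Rightarrow> ('a \<Rightarrow> 'a \<Rightarrow> 'a) \<Rightarrow>
     nat \<Rightarrow> ('a list \<Rightarrow> 'a) \<Rightarrow> 'a list \<Rightarrow> 'a" where
  "d_hoch scale \<mu> n f = hochschild scale \<mu> \<mu> \<mu> n f"

definition mult_R ::
    "('k::field \<Rightarrow> 'a::ab_group_add \<Rightarrow> 'a) \<Rightarrow> 'k \<Rightarrow> ('a \<Rightarrow> 'a \<Rightarrow> 'a) \<Rightarrow> ('a \<Rightarrow> 'a) \<Rightarrow> 'a \<Rightarrow> 'a \<Rightarrow> 'a" where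
  "mult_R scale w \<mu> R x y = \<mu> x (R y) + \<mu> (R x) y + scale w (\<mu> x y)"

definition left_R :: "('a::ab_group_add \<Rightarrow> 'a \<Rightarrow> 'a) \<Rightarrow> ('a \<Rightarrow> 'a) \<Rightarrow> 'a \<Rightarrow> 'a \<Rightarrow> 'a" where
  "left_R \<mu> R x m = \<mu> (R x) m - R (\<mu> x m)"

definition right_R :: "('a::ab_group_add \<Rightarrow> 'a \<Rightarrow> 'a) \<Rightarrow> ('a \<Rightarrow> 'a) \<Rightarrow> 'a \<Rightarrow> 'a \<Rightarrow> 'a" where
  "right_R \<mu> R m x = \<mu> m (R x) - R (\<mu> m x)"

definition d_R_hoch ::
    "('k::field \<Rightarrow> 'a::ab_group_add \<Rightarrow> 'a) \<Rightarrow> 'k \<Rightarrow> ('a \<Rightarrow> 'a \<Rightarrow> 'a) \<Rightarrow> ('a \<Rightarrow> 'a) \<Rightarrow>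
     nat \<Rightarrow> ('a list \<Rightarrow> 'a) \<Rightarrow> 'a list \<Rightarrow> 'a" where
  "d_R_hoch scale w \<mu> R n f =
     hochschild scale (left_R \<mu> R) (mult_R scale w \<mu> R) (right_R \<mu> R) n f"

definition der_op ::
    "('a::ab_group_add \<Rightarrow> 'a) \<Rightarrow> nat \<Rightarrow> ('a list \<Rightarrow> 'a) \<Rightarrow> 'a list \<Rightarrow> 'a" where
  "der_op \<delta> n f = (\<lambda>xs. if length xs = n then
       (\<Sum>i<n. f (xs[i := \<delta> (xs ! i)])) - \<delta> (f xs) else 0)"

definition apply_at :: "nat set \<Rightarrow> ('a \<Rightarrow> 'a) \<Rightarrow> 'a list \<Rightarrow> 'a list" where
  "apply_at I R xs = map (\<lambda>i. if i \<in> I then R (xs ! i) else xs ! i) [0..<length xs]"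

definition Phi_op ::
    "('k::field \<Rightarrow> 'a::ab_group_add \<Rightarrow> 'a) \<Rightarrow> 'k \<Rightarrow> ('a \<Rightarrow> 'a) \<Rightarrow>
     nat \<Rightarrow> ('a list \<Rightarrow> 'a) \<Rightarrow> 'a list \<Rightarrow> 'a" where
  "Phi_op scale w R n f = (\<lambda>xs. if length xs = n then
       f (map R xs)
       - (\<Sum>k<n. scale (w ^ (n - k - 1))
            (\<Sum>I | I \<subseteq> {..<n} \<and> card I = k. R (f (apply_at I R xs))))
     else 0)"

text \<open>Cochains of all degrees live in one product type: in degree 1 the two additional
  components are zero, so that degree 1 is \<open>Hom(A, A)\<close>.\<close>

type_synonym 'a rb_cochain = "(('a list \<Rightarrow> 'a) \<times> ('a list \<Rightarrow> 'a)) \<times> ('a list \<Rightarrow> 'a)"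

definition rb_cochains ::
    "('k::field \<Rightarrow> 'a::ab_group_add \<Rightarrow> 'a) \<Rightarrow> nat \<Rightarrow> 'a rb_cochain set" where
  "rb_cochains scale n =
     (if n = 0 then {0}
      else if n = 1 then (hom_tensor scale 1 \<times> {0}) \<times> {0}
      else (hom_tensor scale n \<times> hom_tensor scale (n - 1)) \<times> hom_tensor scale (n - 1))"

definition rb_differential ::
    "('k::field \<Rightarrow> 'a::ab_group_add \<Rightarrow> 'a) \<Rightarrow> 'k \<Rightarrow> ('a \<Rightarrow> 'a \<Rightarrow> 'a) \<Rightarrow> ('a \<Rightarrow> 'a) \<Rightarrow> ('a \<Rightarrow> 'a) \<Rightarrow>
     nat \<Rightarrow> 'a rb_cochain \<Rightarrow> 'a rb_cochain" where
  "rb_differential scale w \<mu> \<delta> R n = (\<lambda>((f, g), h).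
     if n = 0 then 0
     else if n = 1 then ((d_hoch scale \<mu> 1 f, - der_op \<delta> 1 f), - Phi_op scale w R 1 f)
     else ((d_hoch scale \<mu> n f,
            d_hoch scale \<mu> (n - 1) g + (\<lambda>xs. scale ((-1) ^ n) (der_op \<delta> n f xs))),
           - d_R_hoch scale w \<mu> R (n - 1) h - Phi_op scale w R n f))"

definition rb_cocycles ::
    "('k::field \<Rightarrow> 'a::ab_group_add \<Rightarrow> 'a) \<Rightarrow> 'k \<Rightarrow> ('a \<Rightarrow> 'a \<Rightarrow> 'a) \<Rightarrow> ('a \<Rightarrow> 'a) \<Rightarrow> ('a \<Rightarrow> 'a) \<Rightarrow>
     nat \<Rightarrow> 'a rb_cochain set" where
  "rb_cocycles scale w \<mu> \<delta> R n =
     {c \<in> rb_cochains scale n. rb_differential scale w \<mu> \<delta> R n c = 0}"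

definition rb_coboundaries ::
    "('k::field \<Rightarrow> 'a::ab_group_add \<Rightarrow> 'a) \<Rightarrow> 'k \<Rightarrow> ('a \<Rightarrow> 'a \<Rightarrow> 'a) \<Rightarrow> ('a \<Rightarrow> 'a) \<Rightarrow> ('a \<Rightarrow> 'a) \<Rightarrow>
     nat \<Rightarrow> 'a rb_cochain set" where
  "rb_coboundaries scale w \<mu> \<delta> R n =
     (if n = 0 then {0}
      else rb_differential scale w \<mu> \<delta> R (n - 1) ` rb_cochains scale (n - 1))"

definition rb_cohomology ::
    "('k::field \<Rightarrow> 'a::ab_group_add \<Rightarrow> 'a) \<Rightarrow> 'k \<Rightarrow> ('a \<Rightarrow> 'a \<Rightarrow> 'a) \<Rightarrow> ('a \<Rightarrow> 'a) \<Rightarrow> ('a \<Rightarrow> 'a) \<Rightarrow>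
     nat \<Rightarrow> 'a rb_cochain set monoid" where
  "rb_cohomology scale w \<mu> \<delta> R n =
     \<lparr>carrier = rb_cocycles scale w \<mu> \<delta> R n, monoid.mult = (+), one = 0\<rparr>
       Mod rb_coboundaries scale w \<mu> \<delta> R n"

end

theory Submission
  imports Defs
begin

text \<open>The trivializing isomorphism \<open>\<phi>\<close> is built one coefficient at a time. Suppose \<open>\<phi>\<close> intertwines the
  constant structure with the deformed one modulo \<open>t\<^sup>n\<close>, so that the three defects
  \<open>\<mu>\<^sub>t(\<phi>x, \<phi>y) - \<phi>\<mu>(x, y)\<close>, \<open>\<delta>\<^sub>t\<phi> - \<phi>\<delta>\<close> and \<open>R\<^sub>t\<phi> - \<phi>R\<close> vanish below degree \<open>n\<close>. Evaluating the
  axioms of the deformation on \<open>\<phi>x\<close>, \<open>\<phi>y\<close>, \<open>\<phi>z\<close> and comparing coefficients of \<open>t\<^sup>n\<close> shows that the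
  leading coefficients of the defects form a 2-cocycle; no inverse of \<open>\<phi>\<close> is involved. This cocycle
  is the coboundary of some \<open>\<psi>\<close>, and replacing \<open>\<phi>\<close> by \<open>\<phi> - t\<^sup>n\<psi>\<close> removes the defects in degree \<open>n\<close>.
  The coefficients of \<open>\<phi>\<close> below \<open>n\<close> are never changed again, so the sequence has a limit.\<close>

section \<open>Maps linear over formal power series\<close>

text \<open>\<open>fps_delay\<close> is multiplication by \<open>t\<close>; the coefficients lie in a group only, so \<open>fps_X\<close> is
  not available.\<close>

definition fps_delay :: "'a::zero fps \<Rightarrow> 'a fps" where
  "fps_delay a = Abs_fps (\<lambda>n. case n of 0 \<Rightarrow> 0 | Suc k \<Rightarrow> a $ k)"

lemma fps_delay_nth [simp]:
  "fps_delay a $ 0 = 0" "fps_delay a $ Suc n = a $ n"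
  by (simp_all add: fps_delay_def)

lemma fps_const_plus_delay:
  fixes a :: "'a::ab_group_add fps"
  shows "a = fps_const (a $ 0) + fps_delay (fps_shift 1 a)"
proof (rule fps_ext)
  fix n show "a $ n = (fps_const (a $ 0) + fps_delay (fps_shift 1 a)) $ n"
    by (cases n) auto
qed

text \<open>In effect linearity over integer polynomials in \<open>t\<close>. Field scalars are
  treated separately, by \<open>ext1_fps_scale\<close> and \<open>ext2_fps_scale\<close>.\<close>

definition t_linear :: "('a::ab_group_add fps \<Rightarrow> 'b::ab_group_add fps) \<Rightarrow> bool" where
  "t_linear F \<longleftrightarrow> additive F \<and> (\<forall>a. F (fps_delay a) = fps_delay (F a))"

lemma t_linearI:
  assumes "\<And>a b. F (a + b) = F a + F b" "\<And>a. F (fps_delay a) = fps_delay (F a)"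
  shows "t_linear F"
  using assms by (simp add: t_linear_def additive_def)

lemma t_linear_add: "t_linear F \<Longrightarrow> F (a + b) = F a + F b"
  and t_linear_delay: "t_linear F \<Longrightarrow> F (fps_delay a) = fps_delay (F a)"
  by (simp_all add: t_linear_def additive_def)

text \<open>Splitting \<open>a\<close> into its constant term and \<open>t\<close> times the shifted
  series reduces coefficient \<open>Suc n\<close> to coefficient \<open>n\<close> of another series,
  hence the induction with \<open>a\<close> arbitrary. This lifts identities known on constants to
  all of \<open>A[[t]]\<close>.\<close>

lemma t_linear_eqI:
  assumes F: "t_linear F" and G: "t_linear G"
    and const: "\<And>x. F (fps_const x) = G (fps_const x)"
  shows "F a = G a"
proof (rule fps_ext)
  fix n show "F a $ n = G a $ n"
  proof (induction n arbitrary: a)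
    case 0
    show ?case
      by (subst (1 2) fps_const_plus_delay)
         (simp add: t_linear_add[OF F] t_linear_add[OF G] t_linear_delay[OF F] t_linear_delay[OF G] const)
  next
    case (Suc n)
    show ?case
      by (subst (1 2) fps_const_plus_delay)
         (simp add: t_linear_add[OF F] t_linear_add[OF G] t_linear_delay[OF F] t_linear_delay[OF G] const Suc)
  qed
qed

lemma t_linear_comp:
  assumes "t_linear F" "t_linear G"
  shows "t_linear (\<lambda>a. F (G a))"
  using assms by (intro t_linearI) (simp_all add: t_linear_add t_linear_delay)

lemma t_linear_plus:
  assumes "t_linear F" "t_linear G"
  shows "t_linear (\<lambda>a. F a + G a)"
proof (rule t_linearI)
  fix a
  have "fps_delay (F a) + fps_delay (G a) = fps_delay (F a + G a)"
    by (rule fps_ext, rename_tac n, case_tac n) auto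
  then show "F (fps_delay a) + G (fps_delay a) = fps_delay (F a + G a)"
    using assms by (simp add: t_linear_delay)
qed (use assms in \<open>simp add: t_linear_add\<close>)

lemma ext1_nth: "ext1 f a $ n = (\<Sum>i\<le>n. (f $ i) (a $ (n - i)))"
  by (simp add: ext1_def)

lemma ext2_nth: "ext2 m a b $ n = (\<Sum>i\<le>n. \<Sum>j\<le>n - i. (m $ i) (a $ j) (b $ (n - i - j)))"
  by (simp add: ext2_def)

lemma fps_scale_nth [simp]: "fps_scale s c a $ n = s c (a $ n)"
  by (simp add: fps_scale_def)

lemma t_linear_ext1:
  assumes f: "\<And>i. additive (f $ i)"
  shows "t_linear (ext1 f)"
proof (rule t_linearI)
  fix a b show "ext1 f (a + b) = ext1 f a + ext1 f b"
    by (rule fps_ext) (simp add: ext1_nth additive.add[OF f] sum.distrib)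
next
  fix a show "ext1 f (fps_delay a) = fps_delay (ext1 f a)"
  proof (rule fps_ext)
    fix n show "ext1 f (fps_delay a) $ n = fps_delay (ext1 f a) $ n"
      by (cases n) (simp_all add: ext1_nth additive.zero[OF f] Suc_diff_le)
  qed
qed

lemma t_linear_ext2_left:
  assumes m: "\<And>i y. additive (\<lambda>x. (m $ i) x y)"
  shows "t_linear (\<lambda>a. ext2 m a b)"
proof (rule t_linearI)
  fix a c show "ext2 m (a + c) b = ext2 m a b + ext2 m c b"
    by (rule fps_ext) (simp add: ext2_nth additive.add[OF m] sum.distrib)
next
  fix a show "ext2 m (fps_delay a) b = fps_delay (ext2 m a b)"
  proof (rule fps_ext)
    fix n show "ext2 m (fps_delay a) b $ n = fps_delay (ext2 m a b) $ n"
    proof (cases n)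
      case (Suc k)
      \<comment> \<open>The delayed series starts with 0, so the term \<open>j = 0\<close> drops out
        and \<open>j\<close> can be shifted. The outer term \<open>i = Suc k\<close> consists of
        \<open>j = 0\<close> only and vanishes as well.\<close>
      have "(\<Sum>j\<le>Suc k - i. (m $ i) (fps_delay a $ j) (b $ (Suc k - i - j)))
              = (\<Sum>j\<le>k - i. (m $ i) (a $ j) (b $ (k - i - j)))" if "i \<le> k" for i
        using that
        by (simp add: Suc_diff_le sum.atMost_Suc_shift additive.zero[OF m] del: sum.atMost_Suc)
      then show ?thesis
        by (simp add: Suc ext2_nth additive.zero[OF m])
    qed (simp add: ext2_nth additive.zero[OF m])
  qed
qed

lemma t_linear_ext2_right:
  assumes m: "\<And>i x. additive ((m $ i) x)"
  shows "t_linear (ext2 m a)"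
proof (rule t_linearI)
  fix b c show "ext2 m a (b + c) = ext2 m a b + ext2 m a c"
    by (rule fps_ext) (simp add: ext2_nth additive.add[OF m] sum.distrib)
next
  fix b show "ext2 m a (fps_delay b) = fps_delay (ext2 m a b)"
  proof (rule fps_ext)
    fix n show "ext2 m a (fps_delay b) $ n = fps_delay (ext2 m a b) $ n"
      by (cases n) (simp_all add: ext2_nth additive.zero[OF m] Suc_diff_le)
  qed
qed

section \<open>Leading coefficients of the extended maps\<close>

lemma ext1_nth_leading:
  assumes f: "\<And>i. additive (f $ i)" and a: "\<And>i. i < n \<Longrightarrow> a $ i = 0"
  shows "ext1 f a $ n = (f $ 0) (a $ n)"
proof -
  have "ext1 f a $ n = (\<Sum>i\<in>{0}. (f $ i) (a $ (n - i)))"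
    unfolding ext1_nth
    by (rule sum.mono_neutral_right) (auto simp: a additive.zero[OF f])
  then show ?thesis by simp
qed

text \<open>If \<open>a\<close> starts in degree \<open>n\<close>, any term of total degree
  \<open>n\<close> that uses a positive degree of \<open>m\<close> or \<open>b\<close> contains a
  coefficient of \<open>a\<close> below \<open>n\<close>, which is zero.\<close>

lemma ext2_nth_leading_left:
  assumes m: "\<And>i y. additive (\<lambda>x. (m $ i) x y)" and a: "\<And>i. i < n \<Longrightarrow> a $ i = 0"
  shows "ext2 m a b $ n = (m $ 0) (a $ n) (b $ 0)"
proof -
  have zero: "(m $ i) (a $ j) (b $ (n - i - j)) = 0" if "i \<noteq> 0" "i \<le> n" "j \<le> n - i" for i j
    using that by (subst a) (auto simp: additive.zero[OF m])
  have "ext2 m a b $ n = (\<Sum>i\<in>{0}. \<Sum>j\<le>n - i. (m $ i) (a $ j) (b $ (n - i - j)))"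
    unfolding ext2_nth
    by (rule sum.mono_neutral_right) (use zero in \<open>auto intro!: sum.neutral\<close>)
  also have "\<dots> = (\<Sum>j\<le>n. (m $ 0) (a $ j) (b $ (n - j)))"
    by simp
  also have "\<dots> = (\<Sum>j\<in>{n}. (m $ 0) (a $ j) (b $ (n - j)))"
    by (rule sum.mono_neutral_right) (auto simp: a additive.zero[OF m])
  finally show ?thesis by simp
qed

lemma ext2_nth_leading_right:
  assumes m: "\<And>i x. additive ((m $ i) x)" and b: "\<And>i. i < n \<Longrightarrow> b $ i = 0"
  shows "ext2 m a b $ n = (m $ 0) (a $ 0) (b $ n)"
proof -
  have zero: "(m $ i) (a $ j) (b $ (n - i - j)) = 0" if "i \<noteq> 0" "i \<le> n" for i j
    using that by (subst b) (auto simp: additive.zero[OF m])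
  have "ext2 m a b $ n = (\<Sum>i\<in>{0}. \<Sum>j\<le>n - i. (m $ i) (a $ j) (b $ (n - i - j)))"
    unfolding ext2_nth
    by (rule sum.mono_neutral_right) (use zero in \<open>auto intro!: sum.neutral\<close>)
  also have "\<dots> = (\<Sum>j\<le>n. (m $ 0) (a $ j) (b $ (n - j)))"
    by simp
  also have "\<dots> = (\<Sum>j\<in>{0}. (m $ 0) (a $ j) (b $ (n - j)))"
    by (rule sum.mono_neutral_right) (auto simp: b additive.zero[OF m])
  finally show ?thesis by simp
qed

lemma ext1_const_nth:
  assumes f: "\<And>i. additive (f $ i)"
  shows "ext1 f (fps_const x) $ n = (f $ n) x"
proof -
  have "ext1 f (fps_const x) $ n = (\<Sum>i\<in>{n}. (f $ i) (fps_const x $ (n - i)))"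
    unfolding ext1_nth
    by (rule sum.mono_neutral_right) (auto simp: additive.zero[OF f])
  then show ?thesis by simp
qed

lemma ext1_fps_const_nth [simp]: "ext1 (fps_const f) a $ n = f (a $ n)"
proof -
  have "ext1 (fps_const f) a $ n = (\<Sum>i\<in>{0}. (fps_const f $ i) (a $ (n - i)))"
    unfolding ext1_nth by (rule sum.mono_neutral_right) auto
  then show ?thesis by simp
qed

lemma ext2_fps_const:
  assumes "\<And>y. m 0 y = 0" "\<And>x. m x 0 = 0"
  shows "ext2 (fps_const m) (fps_const x) (fps_const y) = fps_const (m x y)"
proof (rule fps_ext)
  fix n show "ext2 (fps_const m) (fps_const x) (fps_const y) $ n = fps_const (m x y) $ n"
    by (cases n) (auto simp: ext2_nth assms intro!: sum.neutral)
qed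

section \<open>Dependence on low coefficients, and invertibility\<close>

lemma ext1_nth_cong:
  assumes "\<And>j. j \<le> n \<Longrightarrow> f $ j = g $ j" "\<And>j. j \<le> n \<Longrightarrow> a $ j = b $ j"
  shows "ext1 f a $ n = ext1 g b $ n"
  unfolding ext1_nth by (rule sum.cong) (simp_all add: assms)

lemma ext2_nth_cong:
  assumes "\<And>j. j \<le> n \<Longrightarrow> a $ j = a' $ j" "\<And>j. j \<le> n \<Longrightarrow> b $ j = b' $ j"
  shows "ext2 m a b $ n = ext2 m a' b' $ n"
  unfolding ext2_nth by (intro sum.cong refl) (simp add: assms)

text \<open>Coefficients of the preimage of \<open>b\<close> under \<open>ext1 f\<close> in the case
  \<open>f $ 0 = id\<close>, each determined by the earlier ones.\<close>

fun ext1_inverse_coeff :: "('a::ab_group_add \<Rightarrow> 'a) fps \<Rightarrow> 'a fps \<Rightarrow> nat \<Rightarrow> 'a" where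
  "ext1_inverse_coeff f b n = b $ n - (\<Sum>i\<in>{1..n}. (f $ i) (ext1_inverse_coeff f b (n - i)))"

declare ext1_inverse_coeff.simps [simp del]

text \<open>The equation \<open>ext1 f a = b\<close> is a triangular system for the coefficients of
  \<open>a\<close> with the identity on the diagonal.\<close>

lemma bij_ext1:
  assumes f0: "f $ 0 = id"
  shows "bij (ext1 f)"
proof (rule bijI)
  have nth: "ext1 f a $ n = a $ n + (\<Sum>i\<in>{1..n}. (f $ i) (a $ (n - i)))" for a n
  proof -
    have "{..n} = insert 0 {1..n}" by auto
    then show ?thesis by (simp add: ext1_nth f0)
  qed
  show "inj (ext1 f)"
  proof (rule injI, rule fps_ext)
    fix a b n assume eq: "ext1 f a = ext1 f b"
    show "a $ n = b $ n"
    proof (induction n rule: less_induct)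
      case (less n)
      have "(\<Sum>i\<in>{1..n}. (f $ i) (a $ (n - i))) = (\<Sum>i\<in>{1..n}. (f $ i) (b $ (n - i)))"
        by (intro sum.cong refl) (simp add: less)
      with arg_cong[OF eq, of "\<lambda>c. c $ n"] show ?case by (simp add: nth)
    qed
  qed
  show "surj (ext1 f)"
  proof (rule surjI)
    fix b show "ext1 f (Abs_fps (ext1_inverse_coeff f b)) = b"
    proof (rule fps_ext)
      fix n show "ext1 f (Abs_fps (ext1_inverse_coeff f b)) $ n = b $ n"
        unfolding nth fps_nth_Abs_fps by (subst ext1_inverse_coeff.simps) simp
    qed
  qed
qed

section \<open>Linear maps and field scalars\<close>

lemma linear_additive: "Vector_Spaces.linear s1 s2 f \<Longrightarrow> additive f"
  by (simp add: Vector_Spaces.linear_iff additive_def)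

lemma (in vector_space) t_linear_fps_scale: "t_linear (fps_scale scale c)"
proof (rule t_linearI)
  fix a show "fps_scale scale c (fps_delay a) = fps_delay (fps_scale scale c a)"
    by (rule fps_ext, rename_tac n, case_tac n) auto
qed (rule fps_ext, simp add: scale_right_distrib)

lemma (in vector_space) ext1_fps_scale:
  assumes "\<And>i. Vector_Spaces.linear scale scale (f $ i)"
  shows "ext1 f (fps_scale scale c a) = fps_scale scale c (ext1 f a)"
  using assms by (intro fps_ext) (simp add: ext1_nth Vector_Spaces.linear_iff scale_sum_right)

lemma (in vector_space) ext2_fps_scale:
  assumes "\<And>i. bilinear_map scale (m $ i)"
  shows "ext2 m (fps_scale scale c a) b = fps_scale scale c (ext2 m a b)"
    and "ext2 m a (fps_scale scale c b) = fps_scale scale c (ext2 m a b)"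
  using assms by (auto intro!: fps_ext simp: ext2_nth bilinear_map_def Vector_Spaces.linear_iff scale_sum_right)

section \<open>Vanishing of the second cohomology\<close>

context rota_baxter_assder_pair
begin

lemma \<mu>_simps:
  "\<mu> (x + y) z = \<mu> x z + \<mu> y z" "\<mu> x (y + z) = \<mu> x y + \<mu> x z"
  "\<mu> (scale c x) y = scale c (\<mu> x y)" "\<mu> x (scale c y) = scale c (\<mu> x y)"
  using mult_bilinear by (auto simp: bilinear_map_def Vector_Spaces.linear_iff)

lemma \<mu>_zero: "\<mu> 0 x = 0" "\<mu> x 0 = 0"
  using \<mu>_simps(3,4)[where c = 0] by simp_all

lemma \<mu>_minus: "\<mu> (- x) y = - \<mu> x y" "\<mu> x (- y) = - \<mu> x y"
  using \<mu>_simps(3,4)[where c = "- 1"] by simp_all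

lemma \<delta>_simps: "\<delta> (x + y) = \<delta> x + \<delta> y" "\<delta> (scale c x) = scale c (\<delta> x)" "\<delta> 0 = 0"
  using der_linear additive.zero[OF linear_additive[OF der_linear]]
  by (auto simp: Vector_Spaces.linear_iff)

lemma R_simps: "R (x + y) = R x + R y" "R (scale c x) = scale c (R x)" "R 0 = 0"
  using rb_linear additive.zero[OF linear_additive[OF rb_linear]]
  by (auto simp: Vector_Spaces.linear_iff)

lemma \<delta>_minus: "\<delta> (- x) = - \<delta> x" and R_minus: "R (- x) = - R x"
  using \<delta>_simps(2)[of "- 1"] R_simps(2)[of "- 1"] by simp_all

text \<open>Triviality leaves a single coset, the unit of the quotient, which is the set of
  coboundaries. So the coset of \<open>c\<close> equals that set; it contains \<open>c\<close>,
  since 0 is a coboundary.\<close>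

lemma cocycles_subset_coboundaries:
  assumes H2: "trivial_group (rb_cohomology scale w \<mu> \<delta> R 2)"
    and c: "c \<in> rb_cocycles scale w \<mu> \<delta> R 2"
  shows "c \<in> rb_coboundaries scale w \<mu> \<delta> R 2"
proof -
  let ?G = "\<lparr>carrier = rb_cocycles scale w \<mu> \<delta> R 2, monoid.mult = (+), one = 0\<rparr>"
  let ?B = "rb_coboundaries scale w \<mu> \<delta> R 2"
  have "?B #>\<^bsub>?G\<^esub> c \<in> carrier (?G Mod ?B)"
    using c by (auto simp: FactGroup_def RCOSETS_def)
  moreover have "carrier (?G Mod ?B) = {?B}"
    using H2 by (simp add: trivial_group_def rb_cohomology_def FactGroup_def)
  ultimately have "?B #>\<^bsub>?G\<^esub> c = ?B"
    by simp
  moreover have "0 \<in> ?B"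
  proof -
    have "rb_differential scale w \<mu> \<delta> R 1 0 = 0"
      by (auto simp: rb_differential_def zero_prod_def d_hoch_def hochschild_def der_op_def
          Phi_op_def \<mu>_zero \<delta>_simps R_simps fun_eq_iff)
    moreover have "0 \<in> rb_cochains scale 1"
      by (auto simp: rb_cochains_def zero_prod_def hom_tensor_def Vector_Spaces.linear_iff vector_space_axioms)
    ultimately show ?thesis
      unfolding rb_coboundaries_def by (auto intro!: image_eqI[of _ _ 0])
  qed
  ultimately show ?thesis
    by (auto simp: r_coset_def)
qed

text \<open>The identities assumed of \<open>f\<close>, \<open>g\<close>, \<open>h\<close> linearize
  associativity, the Leibniz rule and the Rota-Baxter relation. Right side minus left side of each
  is one component of the differential of \<open>((f, g), h)\<close>; the three conclusions spell
  out the differential of \<open>\<psi>\<close> in degree 1.\<close>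

lemma cocycle_is_coboundary:
  assumes H2: "trivial_group (rb_cohomology scale w \<mu> \<delta> R 2)"
    and f: "bilinear_map scale f"
    and g: "Vector_Spaces.linear scale scale g"
    and h: "Vector_Spaces.linear scale scale h"
    and f_cocycle: "\<And>x y z. f (\<mu> x y) z + \<mu> (f x y) z = f x (\<mu> y z) + \<mu> x (f y z)"
    and g_cocycle: "\<And>x y. g (\<mu> x y) + \<delta> (f x y) =
       f (\<delta> x) y + \<mu> (g x) y + (f x (\<delta> y) + \<mu> x (g y))"
    and h_cocycle: "\<And>x y. f (R x) (R y) + \<mu> (R x) (h y) + \<mu> (h x) (R y) =
       h (\<mu> (R x) y + \<mu> x (R y) + scale w (\<mu> x y)) +
       R (f (R x) y + \<mu> (h x) y + (f x (R y) + \<mu> x (h y)) + scale w (f x y))"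
  obtains \<psi> where "Vector_Spaces.linear scale scale \<psi>"
    and "\<And>x y. f x y = \<mu> x (\<psi> y) - \<psi> (\<mu> x y) + \<mu> (\<psi> x) y"
    and "\<And>x. g x = \<delta> (\<psi> x) - \<psi> (\<delta> x)"
    and "\<And>x. h x = R (\<psi> x) - \<psi> (R x)"
proof -
  \<comment> \<open>The value 0 on lists of the wrong length is what \<open>hom_tensor\<close>
    demands.\<close>
  define F where "F xs = (if length xs = 2 then f (xs ! 0) (xs ! 1) else 0)" for xs
  define G where "G xs = (if length xs = 1 then g (xs ! 0) else 0)" for xs
  define H where "H xs = (if length xs = 1 then h (xs ! 0) else 0)" for xs
  have two: "{Suc 0..2} = {1, 2}" "{..<2::nat} = {0, 1}"
    by auto
  \<comment> \<open>These index sets occur in the inner sums of \<open>Phi_op\<close>. As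
    \<open>card\<close> is also 0 on infinite sets, finiteness has to be used.\<close>
  have subsets0: "{I. I \<subseteq> {..<n} \<and> card I = 0} = {{}}" for n :: nat
    by (auto dest: finite_subset)
  have subsets1: "{I. I \<subseteq> {0, Suc 0} \<and> card I = Suc 0} = {{0}, {1}}"
    by (auto simp: card_Suc_eq)
  have "((F, G), H) \<in> rb_cochains scale 2"
    using f g h
    by (auto simp: rb_cochains_def hom_tensor_def F_def G_def H_def bilinear_map_def
        length_Suc_conv numeral_2_eq_2 less_Suc_eq)
  moreover have "d_hoch scale \<mu> 2 F = 0"
  proof
    fix xs show "d_hoch scale \<mu> 2 F xs = 0 xs"
    proof (cases "length xs = 3")
      case True
      then obtain a b c where "xs = [a, b, c]" by (auto simp: length_Suc_conv numeral_eq_Suc)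
      then show ?thesis
        using f_cocycle[of a b c] by (simp add: d_hoch_def hochschild_def F_def two algebra_simps)
    qed (simp add: d_hoch_def hochschild_def)
  qed
  moreover have "d_hoch scale \<mu> 1 G + (\<lambda>xs. scale ((-1) ^ 2) (der_op \<delta> 2 F xs)) = 0"
  proof
    fix xs show "(d_hoch scale \<mu> 1 G + (\<lambda>xs. scale ((-1) ^ 2) (der_op \<delta> 2 F xs))) xs = 0 xs"
    proof (cases "length xs = 2")
      case True
      then obtain a b where "xs = [a, b]" by (auto simp: length_Suc_conv numeral_eq_Suc)
      then show ?thesis
        using g_cocycle[of a b]
        by (simp add: d_hoch_def hochschild_def der_op_def F_def G_def two algebra_simps)
    qed (simp add: d_hoch_def hochschild_def der_op_def)
  qed
  \<comment> \<open>For two arguments, \<open>k = 0\<close> contributes the term of weight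
    \<open>w\<close> in \<open>Phi_op\<close> and \<open>k = 1\<close> the two terms with a single
    \<open>R\<close>.\<close>
  moreover have "- d_R_hoch scale w \<mu> R 1 H - Phi_op scale w R 2 F = 0"
  proof
    fix xs show "(- d_R_hoch scale w \<mu> R 1 H - Phi_op scale w R 2 F) xs = 0 xs"
    proof (cases "length xs = 2")
      case True
      then obtain a b where "xs = [a, b]" by (auto simp: length_Suc_conv numeral_eq_Suc)
      then show ?thesis
        using h_cocycle[of a b] subsets0[of 2]
        by (simp add: d_R_hoch_def hochschild_def Phi_op_def F_def H_def two subsets1 apply_at_def
            left_R_def right_R_def mult_R_def R_simps upt_rec algebra_simps)
    qed (simp add: d_R_hoch_def hochschild_def Phi_op_def)
  qed
  ultimately have "((F, G), H) \<in> rb_cocycles scale w \<mu> \<delta> R 2"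
    by (simp add: rb_cocycles_def rb_differential_def zero_prod_def)
  then have "((F, G), H) \<in> rb_coboundaries scale w \<mu> \<delta> R 2"
    by (rule cocycles_subset_coboundaries[OF H2])
  then obtain p where p: "p \<in> hom_tensor scale 1"
    and FGH: "F = d_hoch scale \<mu> 1 p" "G = - der_op \<delta> 1 p" "H = - Phi_op scale w R 1 p"
    by (auto simp: rb_coboundaries_def rb_cochains_def rb_differential_def)
  show thesis
  proof (rule that[of "\<lambda>x. p [x]"])
    have "\<forall>xs. length xs = 1 \<longrightarrow> Vector_Spaces.linear scale scale (\<lambda>x. p (xs[0 := x]))"
      using p by (auto simp: hom_tensor_def)
    \<comment> \<open>The entry 0 is a dummy: the update overwrites it.\<close>
    from this[rule_format, of "[0]"] show "Vector_Spaces.linear scale scale (\<lambda>x. p [x])"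
      by simp
  next
    fix x y show "f x y = \<mu> x (p [y]) - p [\<mu> x y] + \<mu> (p [x]) y"
      using fun_cong[OF FGH(1), of "[x, y]"] by (simp add: F_def d_hoch_def hochschild_def)
  next
    fix x show "g x = \<delta> (p [x]) - p [\<delta> x]"
      using fun_cong[OF FGH(2), of "[x]"] by (simp add: G_def der_op_def)
  next
    fix x show "h x = R (p [x]) - p [R x]"
      using fun_cong[OF FGH(3), of "[x]"] subsets0[of 1]
      by (simp add: H_def Phi_op_def apply_at_def)
  qed
qed

end

section \<open>Deformations and their trivialization\<close>

locale rb_formal_deformation = rota_baxter_assder_pair +
  fixes \<mu>t :: "('b \<Rightarrow> 'b \<Rightarrow> 'b) fps" and \<delta>t Rt :: "('b \<Rightarrow> 'b) fps"
  assumes deformation: "formal_deformation scale w \<mu> \<delta> R \<mu>t \<delta>t Rt"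
begin

section \<open>Deformation axioms for arbitrary power series\<close>

lemma bilinear_\<mu>t: "bilinear_map scale (\<mu>t $ i)" and \<mu>t_0: "\<mu>t $ 0 = \<mu>"
  and linear_\<delta>t: "Vector_Spaces.linear scale scale (\<delta>t $ i)" and \<delta>t_0: "\<delta>t $ 0 = \<delta>"
  and linear_Rt: "Vector_Spaces.linear scale scale (Rt $ i)" and Rt_0: "Rt $ 0 = R"
  using deformation by (simp_all add: formal_deformation_def)

lemma additive_\<mu>t: "additive (\<lambda>x. (\<mu>t $ i) x y)" "additive ((\<mu>t $ i) x)"
  using bilinear_\<mu>t[of i] by (auto simp: bilinear_map_def intro: linear_additive)

lemmas additive_\<delta>t = linear_additive[OF linear_\<delta>t]
lemmas additive_Rt = linear_additive[OF linear_Rt]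

lemmas t_linear_ext2_\<mu>t =
  t_linear_ext2_left[of \<mu>t, OF additive_\<mu>t(1)] t_linear_ext2_right[of \<mu>t, OF additive_\<mu>t(2)]
lemmas t_linear_ext1_\<delta>t = t_linear_ext1[of \<delta>t, OF additive_\<delta>t]
lemmas t_linear_ext1_Rt = t_linear_ext1[of Rt, OF additive_Rt]

text \<open>The axiom is given on constants. Both sides are \<open>t_linear\<close> in each
  variable, so \<open>t_linear_eqI\<close> frees one variable at a time: \<open>c\<close>, then
  \<open>b\<close>, then \<open>a\<close>.\<close>

lemma ext2_\<mu>t_assoc: "ext2 \<mu>t (ext2 \<mu>t a b) c = ext2 \<mu>t a (ext2 \<mu>t b c)"
proof -
  note L = t_linear_ext2_\<mu>t(1) and R = t_linear_ext2_\<mu>t(2)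
  have "ext2 \<mu>t (ext2 \<mu>t (fps_const x) (fps_const y)) c = ext2 \<mu>t (fps_const x) (ext2 \<mu>t (fps_const y) c)"
    for x y c
    by (rule t_linear_eqI[OF R t_linear_comp[OF R R]])
       (use deformation in \<open>simp add: formal_deformation_def Let_def\<close>)
  then have "ext2 \<mu>t (ext2 \<mu>t (fps_const x) b) c = ext2 \<mu>t (fps_const x) (ext2 \<mu>t b c)" for x b c
    by (rule t_linear_eqI[OF t_linear_comp[OF L R] t_linear_comp[OF R L]])
  then show ?thesis
    by (rule t_linear_eqI[OF t_linear_comp[OF L L] L])
qed

lemma ext1_\<delta>t_derivation:
  "ext1 \<delta>t (ext2 \<mu>t a b) = ext2 \<mu>t (ext1 \<delta>t a) b + ext2 \<mu>t a (ext1 \<delta>t b)"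
proof -
  note L = t_linear_ext2_\<mu>t(1) and R = t_linear_ext2_\<mu>t(2) and D = t_linear_ext1_\<delta>t
  have "ext1 \<delta>t (ext2 \<mu>t (fps_const x) b) =
      ext2 \<mu>t (ext1 \<delta>t (fps_const x)) b + ext2 \<mu>t (fps_const x) (ext1 \<delta>t b)" for x b
    by (rule t_linear_eqI[OF t_linear_comp[OF D R] t_linear_plus[OF R t_linear_comp[OF R D]]])
       (use deformation in \<open>simp add: formal_deformation_def Let_def\<close>)
  then show ?thesis
    by (rule t_linear_eqI[OF t_linear_comp[OF D L] t_linear_plus[OF t_linear_comp[OF L D] L]])
qed

lemma ext1_Rt_rota_baxter:
  "ext2 \<mu>t (ext1 Rt a) (ext1 Rt b) =
     ext1 Rt (ext2 \<mu>t (ext1 Rt a) b + ext2 \<mu>t a (ext1 Rt b) + fps_scale scale w (ext2 \<mu>t a b))"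
proof -
  note L = t_linear_ext2_\<mu>t(1) and R = t_linear_ext2_\<mu>t(2) and T = t_linear_ext1_Rt
    and S = t_linear_fps_scale
  have "ext2 \<mu>t (ext1 Rt (fps_const x)) (ext1 Rt b) =
      ext1 Rt (ext2 \<mu>t (ext1 Rt (fps_const x)) b + ext2 \<mu>t (fps_const x) (ext1 Rt b)
        + fps_scale scale w (ext2 \<mu>t (fps_const x) b))" for x b
    by (rule t_linear_eqI[OF t_linear_comp[OF R T]
          t_linear_comp[OF T t_linear_plus[OF t_linear_plus[OF R t_linear_comp[OF R T]] t_linear_comp[OF S R]]]])
       (use deformation in \<open>simp add: formal_deformation_def Let_def\<close>)
  then show ?thesis
    by (rule t_linear_eqI[OF t_linear_comp[OF L T]
          t_linear_comp[OF T t_linear_plus[OF t_linear_plus[OF t_linear_comp[OF L T] L] t_linear_comp[OF S L]]]])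
qed

section \<open>Defects of a candidate isomorphism and their cocycle identities\<close>

definition defect_\<mu> :: "('b \<Rightarrow> 'b) fps \<Rightarrow> 'b \<Rightarrow> 'b \<Rightarrow> 'b fps" where
  "defect_\<mu> \<phi> x y =
     ext2 \<mu>t (ext1 \<phi> (fps_const x)) (ext1 \<phi> (fps_const y)) - ext1 \<phi> (fps_const (\<mu> x y))"

definition defect_\<delta> :: "('b \<Rightarrow> 'b) fps \<Rightarrow> 'b \<Rightarrow> 'b fps" where
  "defect_\<delta> \<phi> x = ext1 \<delta>t (ext1 \<phi> (fps_const x)) - ext1 \<phi> (fps_const (\<delta> x))"

definition defect_R :: "('b \<Rightarrow> 'b) fps \<Rightarrow> 'b \<Rightarrow> 'b fps" where
  "defect_R \<phi> x = ext1 Rt (ext1 \<phi> (fps_const x)) - ext1 \<phi> (fps_const (R x))"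

definition trivializes_below :: "nat \<Rightarrow> ('b \<Rightarrow> 'b) fps \<Rightarrow> bool" where
  "trivializes_below n \<phi> \<longleftrightarrow>
     (\<forall>i. Vector_Spaces.linear scale scale (\<phi> $ i)) \<and> \<phi> $ 0 = id \<and>
     (\<forall>i<n. \<forall>x y. defect_\<mu> \<phi> x y $ i = 0 \<and> defect_\<delta> \<phi> x $ i = 0 \<and> defect_R \<phi> x $ i = 0)"

context
  fixes \<phi> n
  assumes \<phi>: "trivializes_below n \<phi>"
begin

lemma linear_\<phi>: "Vector_Spaces.linear scale scale (\<phi> $ i)" and \<phi>_0: "\<phi> $ 0 = id"
  and defect_below: "i < n \<Longrightarrow> defect_\<mu> \<phi> x y $ i = 0" "i < n \<Longrightarrow> defect_\<delta> \<phi> x $ i = 0"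
    "i < n \<Longrightarrow> defect_R \<phi> x $ i = 0"
  using \<phi> by (auto simp: trivializes_below_def)

lemmas additive_\<phi> = linear_additive[OF linear_\<phi>]

abbreviation (input) P where "P x \<equiv> ext1 \<phi> (fps_const x)"

lemma P_nth: "P x $ i = (\<phi> $ i) x"
  by (rule ext1_const_nth[OF additive_\<phi>])

lemma P_add: "P (x + y) = P x + P y"
  and P_scale: "P (scale c x) = fps_scale scale c (P x)"
  using linear_\<phi> by (auto intro!: fps_ext simp: P_nth Vector_Spaces.linear_iff)

lemmas m_addL = t_linear_add[OF t_linear_ext2_\<mu>t(1)]
lemmas m_addR = t_linear_add[OF t_linear_ext2_\<mu>t(2)]
lemmas D_add = t_linear_add[OF t_linear_ext1_\<delta>t]
lemmas T_add = t_linear_add[OF t_linear_ext1_Rt]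
lemmas S_add = t_linear_add[OF t_linear_fps_scale]

text \<open>Rewrite rules that move an operation through \<open>\<phi>\<close> at the price of a
  defect.\<close>

lemma expand_\<mu>: "ext2 \<mu>t (P x) (P y) = P (\<mu> x y) + defect_\<mu> \<phi> x y"
  and expand_\<delta>: "ext1 \<delta>t (P x) = P (\<delta> x) + defect_\<delta> \<phi> x"
  and expand_R: "ext1 Rt (P x) = P (R x) + defect_R \<phi> x"
  by (simp_all add: defect_\<mu>_def defect_\<delta>_def defect_R_def)

text \<open>Defects start in degree \<open>n\<close>. The range \<open>k \<le> n\<close> covers the
  lower degrees too, where both sides are zero; the Rota-Baxter identity uses those to see that its
  error term starts in degree \<open>n\<close>.\<close>

lemma leading_\<mu>L:
  assumes "k \<le> n"
  shows "ext2 \<mu>t (defect_\<mu> \<phi> x y) b $ k = \<mu> (defect_\<mu> \<phi> x y $ k) (b $ 0)"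
    "ext2 \<mu>t (defect_\<delta> \<phi> x) b $ k = \<mu> (defect_\<delta> \<phi> x $ k) (b $ 0)"
    "ext2 \<mu>t (defect_R \<phi> x) b $ k = \<mu> (defect_R \<phi> x $ k) (b $ 0)"
  using ext2_nth_leading_left[of \<mu>t k, OF additive_\<mu>t(1)] assms by (simp_all add: \<mu>t_0 defect_below)

lemma leading_\<mu>R:
  assumes "k \<le> n"
  shows "ext2 \<mu>t b (defect_\<mu> \<phi> x y) $ k = \<mu> (b $ 0) (defect_\<mu> \<phi> x y $ k)"
    "ext2 \<mu>t b (defect_\<delta> \<phi> x) $ k = \<mu> (b $ 0) (defect_\<delta> \<phi> x $ k)"
    "ext2 \<mu>t b (defect_R \<phi> x) $ k = \<mu> (b $ 0) (defect_R \<phi> x $ k)"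
  using ext2_nth_leading_right[of \<mu>t k, OF additive_\<mu>t(2)] assms by (simp_all add: \<mu>t_0 defect_below)

text \<open>Both bracketings of \<open>P x\<close>, \<open>P y\<close>, \<open>P z\<close> expand to
  the same \<open>P\<close> term, by \<open>mult_assoc\<close>, plus defects. In degree
  \<open>n\<close> a product with a defect sees only \<open>\<mu>\<close> and the constant term of
  the other factor, where \<open>\<phi>\<close> is the identity.\<close>

lemma defect_cocycle_\<mu>:
  "defect_\<mu> \<phi> (\<mu> x y) z $ n + \<mu> (defect_\<mu> \<phi> x y $ n) z =
   defect_\<mu> \<phi> x (\<mu> y z) $ n + \<mu> x (defect_\<mu> \<phi> y z $ n)"
proof -
  have "(P (\<mu> (\<mu> x y) z) + defect_\<mu> \<phi> (\<mu> x y) z + ext2 \<mu>t (defect_\<mu> \<phi> x y) (P z)) $ n =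
        (P (\<mu> x (\<mu> y z)) + defect_\<mu> \<phi> x (\<mu> y z) + ext2 \<mu>t (P x) (defect_\<mu> \<phi> y z)) $ n"
    using ext2_\<mu>t_assoc[of "P x" "P y" "P z"]
    by (simp only: expand_\<mu> m_addL m_addR)
  then show ?thesis
    by (simp add: leading_\<mu>L leading_\<mu>R P_nth \<phi>_0 mult_assoc)
qed

lemma defect_cocycle_\<delta>:
  "defect_\<delta> \<phi> (\<mu> x y) $ n + \<delta> (defect_\<mu> \<phi> x y $ n) =
   defect_\<mu> \<phi> (\<delta> x) y $ n + \<mu> (defect_\<delta> \<phi> x $ n) y
   + (defect_\<mu> \<phi> x (\<delta> y) $ n + \<mu> x (defect_\<delta> \<phi> y $ n))"
proof -
  have "(P (\<delta> (\<mu> x y)) + defect_\<delta> \<phi> (\<mu> x y) + ext1 \<delta>t (defect_\<mu> \<phi> x y)) $ n =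
        (P (\<mu> (\<delta> x) y) + defect_\<mu> \<phi> (\<delta> x) y + ext2 \<mu>t (defect_\<delta> \<phi> x) (P y)
         + (P (\<mu> x (\<delta> y)) + defect_\<mu> \<phi> x (\<delta> y) + ext2 \<mu>t (P x) (defect_\<delta> \<phi> y))) $ n"
    using ext1_\<delta>t_derivation[of "P x" "P y"]
    by (simp only: expand_\<mu> expand_\<delta> m_addL m_addR D_add)
  moreover have "ext1 \<delta>t (defect_\<mu> \<phi> x y) $ n = \<delta> (defect_\<mu> \<phi> x y $ n)"
    by (simp add: ext1_nth_leading additive_\<delta>t defect_below \<delta>t_0)
  ultimately show ?thesis
    by (simp add: leading_\<mu>L leading_\<mu>R P_nth \<phi>_0 derivation additive.add[OF additive_\<phi>] algebra_simps)
qed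

lemma defect_cocycle_R:
  "defect_\<mu> \<phi> (R x) (R y) $ n + \<mu> (R x) (defect_R \<phi> y $ n) + \<mu> (defect_R \<phi> x $ n) (R y) =
   defect_R \<phi> (\<mu> (R x) y + \<mu> x (R y) + scale w (\<mu> x y)) $ n +
   R (defect_\<mu> \<phi> (R x) y $ n + \<mu> (defect_R \<phi> x $ n) y
      + (defect_\<mu> \<phi> x (R y) $ n + \<mu> x (defect_R \<phi> y $ n)) + scale w (defect_\<mu> \<phi> x y $ n))"
  (is "_ = defect_R \<phi> ?B $ n + R ?e")
proof -
  \<comment> \<open>What the argument of \<open>Rt\<close> in the Rota-Baxter relation contains
    beyond \<open>P ?B\<close>. It starts in degree \<open>n\<close>, so only \<open>R\<close> acts
    on its leading coefficient.\<close>
  define e where "e = defect_\<mu> \<phi> (R x) y + ext2 \<mu>t (defect_R \<phi> x) (P y)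
    + (defect_\<mu> \<phi> x (R y) + ext2 \<mu>t (P x) (defect_R \<phi> y)) + fps_scale scale w (defect_\<mu> \<phi> x y)"
  have P_B: "P ?B = P (\<mu> (R x) y) + P (\<mu> x (R y)) + fps_scale scale w (P (\<mu> x y))"
    by (simp only: P_add P_scale)
  have "ext2 \<mu>t (ext1 Rt (P x)) (P y) + ext2 \<mu>t (P x) (ext1 Rt (P y))
      + fps_scale scale w (ext2 \<mu>t (P x) (P y)) = P ?B + e"
    unfolding P_B e_def by (simp only: expand_\<mu> expand_R m_addL m_addR S_add add_ac)
  \<comment> \<open>Keeping \<open>ext1 Rt (P y)\<close> intact in the last summand avoids a product
    of two defects; only its constant term \<open>R y\<close> matters in degree
    \<open>n\<close>.\<close>
  moreover have "ext2 \<mu>t (ext1 Rt (P x)) (ext1 Rt (P y)) = P (\<mu> (R x) (R y)) +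
      defect_\<mu> \<phi> (R x) (R y) + ext2 \<mu>t (P (R x)) (defect_R \<phi> y) + ext2 \<mu>t (defect_R \<phi> x) (ext1 Rt (P y))"
    by (subst expand_R[of x]) (simp only: m_addL, simp only: expand_R m_addR expand_\<mu> add_ac)
  ultimately have "(P (\<mu> (R x) (R y)) + defect_\<mu> \<phi> (R x) (R y) + ext2 \<mu>t (P (R x)) (defect_R \<phi> y)
      + ext2 \<mu>t (defect_R \<phi> x) (ext1 Rt (P y))) $ n = (P (R ?B) + defect_R \<phi> ?B + ext1 Rt e) $ n"
    using ext1_Rt_rota_baxter[of "P x" "P y"] by (simp only: T_add expand_R)
  moreover have "ext1 Rt e $ n = R (e $ n)"
  proof -
    have "e $ i = 0" if "i < n" for i
      using that by (simp add: e_def leading_\<mu>L leading_\<mu>R defect_below \<mu>_zero)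
    then show ?thesis by (simp add: ext1_nth_leading additive_Rt Rt_0)
  qed
  moreover have "e $ n = ?e"
    by (simp add: e_def leading_\<mu>L leading_\<mu>R P_nth \<phi>_0)
  moreover have "ext1 Rt (P y) $ 0 = R y"
    by (simp add: ext1_nth P_nth \<phi>_0 Rt_0)
  ultimately show ?thesis
    by (simp add: leading_\<mu>L leading_\<mu>R P_nth \<phi>_0 rota_baxter)
qed

text \<open>Makes the degree \<open>n\<close> coefficients of the defects cochains.\<close>

lemma bilinear_defect_\<mu>: "bilinear_map scale (\<lambda>x y. defect_\<mu> \<phi> x y $ n)"
  and linear_defect_\<delta>: "Vector_Spaces.linear scale scale (\<lambda>x. defect_\<delta> \<phi> x $ n)"
  and linear_defect_R: "Vector_Spaces.linear scale scale (\<lambda>x. defect_R \<phi> x $ n)"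
  unfolding bilinear_map_def Vector_Spaces.linear_iff defect_\<mu>_def defect_\<delta>_def defect_R_def
  by (simp_all add: vector_space_axioms P_add P_scale m_addL m_addR D_add T_add \<mu>_simps \<delta>_simps R_simps
      ext2_fps_scale bilinear_\<mu>t ext1_fps_scale linear_\<delta>t linear_Rt scale_right_diff_distrib
      del: fps_const_add)

end

section \<open>Construction degree by degree, and its limit\<close>

lemma extend_trivialization:
  assumes H2: "trivial_group (rb_cohomology scale w \<mu> \<delta> R 2)"
    and \<phi>: "trivializes_below n \<phi>" and n: "0 < n"
  shows "\<exists>\<phi>'. trivializes_below (Suc n) \<phi>' \<and> (\<forall>i<n. \<phi>' $ i = \<phi> $ i)"
proof -
  obtain \<psi> where \<psi>: "Vector_Spaces.linear scale scale \<psi>"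
    and cob: "\<And>x y. defect_\<mu> \<phi> x y $ n = \<mu> x (\<psi> y) - \<psi> (\<mu> x y) + \<mu> (\<psi> x) y"
      "\<And>x. defect_\<delta> \<phi> x $ n = \<delta> (\<psi> x) - \<psi> (\<delta> x)"
      "\<And>x. defect_R \<phi> x $ n = R (\<psi> x) - \<psi> (R x)"
    by (rule cocycle_is_coboundary[OF H2 bilinear_defect_\<mu>[OF \<phi>] linear_defect_\<delta>[OF \<phi>]
          linear_defect_R[OF \<phi>] defect_cocycle_\<mu>[OF \<phi>] defect_cocycle_\<delta>[OF \<phi>] defect_cocycle_R[OF \<phi>]])
       blast
  let ?P = "\<lambda>x. ext1 \<phi> (fps_const x)"
  define \<phi>' where "\<phi>' = Abs_fps (\<lambda>i. if i = n then (\<lambda>x. (\<phi> $ n) x - \<psi> x) else \<phi> $ i)"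
  \<comment> \<open>The change in the image of a constant \<open>x\<close>, namely minus
    \<open>t\<close> to the power \<open>n\<close> times \<open>\<psi> x\<close>.\<close>
  define e where "e x = Abs_fps (\<lambda>i. if i = n then - \<psi> x else 0)" for x
  have linear_\<phi>': "Vector_Spaces.linear scale scale (\<phi>' $ i)" for i
    using linear_\<phi>[OF \<phi>, of i] \<psi>
    by (auto simp: \<phi>'_def Vector_Spaces.linear_iff scale_right_diff_distrib)
  have \<phi>'_const: "ext1 \<phi>' (fps_const x) = ?P x + e x" for x
    by (rule fps_ext)
       (simp add: ext1_const_nth linear_additive[OF linear_\<phi>'] additive_\<phi>[OF \<phi>], simp add: \<phi>'_def e_def)
  \<comment> \<open>Here \<open>0 < n\<close> enters: the cross term of \<open>e x\<close> and
    \<open>e y\<close> starts in degree \<open>2 n\<close>, hence does not reach degree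
    \<open>n\<close>.\<close>
  have e_0: "e x $ 0 = 0" for x
    using n by (simp add: e_def)
  have P_0: "?P x $ 0 = x" for x
    by (simp add: P_nth[OF \<phi>] \<phi>_0[OF \<phi>])
  have e_below: "e x $ i = 0" if "i < n" for x i
    using that by (simp add: e_def)
  have e_n: "e x $ n = - \<psi> x" for x
    by (simp add: e_def)
  have eL: "ext2 \<mu>t (e x) b $ i = \<mu> (e x $ i) (b $ 0)"
    and eR: "ext2 \<mu>t b (e x) $ i = \<mu> (b $ 0) (e x $ i)"
    and e\<delta>: "ext1 \<delta>t (e x) $ i = \<delta> (e x $ i)"
    and eT: "ext1 Rt (e x) $ i = R (e x $ i)" if "i \<le> n" for x b i
    using that e_below
    by (simp_all add: ext2_nth_leading_left[OF additive_\<mu>t(1)] ext2_nth_leading_right[OF additive_\<mu>t(2)]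
        ext1_nth_leading additive_\<delta>t additive_Rt \<mu>t_0 \<delta>t_0 Rt_0)
  note m_addL = t_linear_add[OF t_linear_ext2_\<mu>t(1)] and m_addR = t_linear_add[OF t_linear_ext2_\<mu>t(2)]
  have zero: "defect_\<mu> \<phi>' x y $ i = 0 \<and> defect_\<delta> \<phi>' x $ i = 0 \<and> defect_R \<phi>' x $ i = 0"
    if "i < Suc n" for i x y
  proof -
    from that have i: "i \<le> n" by simp
    have "defect_\<mu> \<phi>' x y $ i = defect_\<mu> \<phi> x y $ i + \<mu> x (e y $ i) + \<mu> (e x $ i) y - e (\<mu> x y) $ i"
      by (simp add: defect_\<mu>_def \<phi>'_const m_addL m_addR eL eR i e_0 P_0 \<mu>_zero)
    moreover have "defect_\<delta> \<phi>' x $ i = defect_\<delta> \<phi> x $ i + \<delta> (e x $ i) - e (\<delta> x) $ i"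
      by (simp add: defect_\<delta>_def \<phi>'_const t_linear_add[OF t_linear_ext1_\<delta>t] e\<delta> i)
    moreover have "defect_R \<phi>' x $ i = defect_R \<phi> x $ i + R (e x $ i) - e (R x) $ i"
      by (simp add: defect_R_def \<phi>'_const t_linear_add[OF t_linear_ext1_Rt] eT i)
    ultimately show ?thesis
      \<comment> \<open>In degree \<open>n\<close> the terms in \<open>e\<close> are the negative of
        the coboundary in \<open>cob\<close>; below \<open>n\<close> they vanish.\<close>
      using i by (cases "i = n")
        (simp_all add: cob e_n e_below defect_below[OF \<phi>] \<mu>_zero \<delta>_simps R_simps \<mu>_minus \<delta>_minus R_minus)
  qed
  have "trivializes_below (Suc n) \<phi>'"
    using linear_\<phi>' zero n \<phi>_0[OF \<phi>] by (simp add: trivializes_below_def \<phi>'_def)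
  then show ?thesis
    by (intro exI[of _ \<phi>']) (simp add: \<phi>'_def)
qed

text \<open>Lets the limit inherit each vanishing defect coefficient from a finite stage.\<close>

lemma defect_nth_cong:
  assumes "\<And>j. j \<le> n \<Longrightarrow> \<phi> $ j = \<phi>' $ j"
  shows "defect_\<mu> \<phi> x y $ n = defect_\<mu> \<phi>' x y $ n"
    and "defect_\<delta> \<phi> x $ n = defect_\<delta> \<phi>' x $ n"
    and "defect_R \<phi> x $ n = defect_R \<phi>' x $ n"
proof -
  have P: "ext1 \<phi> (fps_const z) $ j = ext1 \<phi>' (fps_const z) $ j" if "j \<le> n" for z j
    using that assms by (intro ext1_nth_cong) simp_all
  show "defect_\<mu> \<phi> x y $ n = defect_\<mu> \<phi>' x y $ n"
    using ext2_nth_cong[OF P P, of n] P by (simp add: defect_\<mu>_def)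
  show "defect_\<delta> \<phi> x $ n = defect_\<delta> \<phi>' x $ n"
    using ext1_nth_cong[OF refl P, of n] P by (simp add: defect_\<delta>_def)
  show "defect_R \<phi> x $ n = defect_R \<phi>' x $ n"
    using ext1_nth_cong[OF refl P, of n] P by (simp add: defect_R_def)
qed

lemma exists_trivialization:
  assumes H2: "trivial_group (rb_cohomology scale w \<mu> \<delta> R 2)"
  shows "\<exists>\<phi>. \<forall>n. trivializes_below n \<phi>"
proof -
  have "Vector_Spaces.linear scale scale (fps_const id $ i)" for i
    by (simp add: Vector_Spaces.linear_iff vector_space_axioms)
  \<comment> \<open>The identity has no defect in degree 0 because the deformation has the given
    structure as its constant term. Starting at \<open>Suc 0\<close> also supplies the positive
    degree required by \<open>extend_trivialization\<close>.\<close>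
  then have "trivializes_below (Suc 0) (fps_const id)"
    by (simp add: trivializes_below_def defect_\<mu>_def defect_\<delta>_def defect_R_def ext2_nth ext1_nth[of \<delta>t]
        ext1_nth[of Rt] \<mu>t_0 \<delta>t_0 Rt_0)
  then obtain F where F: "trivializes_below (Suc n) (F n)"
    and step: "\<forall>i<Suc n. F (Suc n) $ i = F n $ i" for n
    using dependent_nat_choice[of "\<lambda>n. trivializes_below (Suc n)"
        "\<lambda>n \<phi> \<phi>'. \<forall>i<Suc n. \<phi>' $ i = \<phi> $ i"] extend_trivialization[OF H2 _ zero_less_Suc]
    by blast
  have stable: "F n $ i = F i $ i" if "i \<le> n" for n i
    using that by (induction n rule: dec_induct) (simp_all add: step)
  \<comment> \<open>Diagonal limit: by \<open>stable\<close> it agrees with \<open>F n\<close> up to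
    degree \<open>n\<close>, and \<open>F n\<close> has no defect in degree
    \<open>n\<close>.\<close>
  define \<phi> where "\<phi> = Abs_fps (\<lambda>n. F n $ n)"
  have "\<phi> $ j = F n $ j" if "j \<le> n" for n j
    by (simp add: \<phi>_def stable[OF that])
  then have "defect_\<mu> \<phi> x y $ n = 0" "defect_\<delta> \<phi> x $ n = 0" "defect_R \<phi> x $ n = 0" for x y n
    using F[of n] defect_nth_cong[of n \<phi> "F n"] by (simp_all add: trivializes_below_def)
  moreover have "Vector_Spaces.linear scale scale (\<phi> $ i)" "\<phi> $ 0 = id" for i
    using F by (simp_all add: trivializes_below_def \<phi>_def)
  ultimately show ?thesis
    unfolding trivializes_below_def by blast
qed

end

theorem theorem4p5:
  fixes scale :: "'k::field \<Rightarrow> 'a::ab_group_add \<Rightarrow> 'a"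
    and w :: 'k
    and \<mu> :: "'a \<Rightarrow> 'a \<Rightarrow> 'a"
    and \<delta> R :: "'a \<Rightarrow> 'a"
    and \<mu>t :: "('a \<Rightarrow> 'a \<Rightarrow> 'a) fps"
    and \<delta>t Rt :: "('a \<Rightarrow> 'a) fps"
  assumes "rota_baxter_assder_pair scale w \<mu> \<delta> R"
    and "trivial_group (rb_cohomology scale w \<mu> \<delta> R 2)"
    and "formal_deformation scale w \<mu> \<delta> R \<mu>t \<delta>t Rt"
  shows "equivalent_deformations scale
           (\<mu>t, \<delta>t, Rt) (fps_const \<mu>, fps_const \<delta>, fps_const R)"
proof -
  interpret rb_formal_deformation scale w \<mu> \<delta> R \<mu>t \<delta>t Rt
    using assms(1,3) by (simp add: rb_formal_deformation_def rb_formal_deformation_axioms_def)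
  obtain \<phi> where \<phi>: "trivializes_below n \<phi>" for n
    using exists_trivialization[OF assms(2)] by blast
  have zero: "defect_\<mu> \<phi> x y = 0" "defect_\<delta> \<phi> x = 0" "defect_R \<phi> x = 0" for x y
    using defect_below[OF \<phi> lessI] by (auto intro!: fps_ext)
  \<comment> \<open>Equivalence asks for equal compositions on all of \<open>A[[t]]\<close>, whereas
    the defects test constants only; \<open>t_linear_eqI\<close> closes the gap.\<close>
  have intertwine: "ext1 \<phi> \<circ> ext1 (fps_const f) = ext1 g \<circ> ext1 \<phi>"
    if f: "additive f" and g: "\<And>i. additive (g $ i)"
      and eq: "\<And>x. ext1 g (ext1 \<phi> (fps_const x)) = ext1 \<phi> (fps_const (f x))" for f g
  proof
    fix a
    have f_i: "additive (fps_const f $ i)" for i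
      using f by (simp add: additive_def)
    have f_const: "ext1 (fps_const f) (fps_const x) = fps_const (f x)" for x
      by (rule fps_ext) (simp add: additive.zero[OF f])
    note t_\<phi> = t_linear_ext1[OF additive_\<phi>[OF \<phi>]]
    have "ext1 \<phi> (ext1 (fps_const f) a) = ext1 g (ext1 \<phi> a)"
      by (rule t_linear_eqI[OF t_linear_comp[OF t_\<phi> t_linear_ext1[OF f_i]]
            t_linear_comp[OF t_linear_ext1[OF g] t_\<phi>]])
         (simp add: f_const eq)
    then show "(ext1 \<phi> \<circ> ext1 (fps_const f)) a = (ext1 g \<circ> ext1 \<phi>) a"
      by simp
  qed
  have "formal_isomorphism scale \<phi>"
    unfolding formal_isomorphism_def using linear_\<phi>[OF \<phi>] \<phi>_0[OF \<phi>] bij_ext1 by blast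
  moreover have "ext1 \<phi> (ext2 (fps_const \<mu>) (fps_const x) (fps_const y)) =
      ext2 \<mu>t (ext1 \<phi> (fps_const x)) (ext1 \<phi> (fps_const y))" for x y
    using zero(1)[of x y] by (simp add: ext2_fps_const \<mu>_zero defect_\<mu>_def)
  moreover have "ext1 \<phi> \<circ> ext1 (fps_const \<delta>) = ext1 \<delta>t \<circ> ext1 \<phi>"
    using zero(2) by (intro intertwine linear_additive[OF der_linear] additive_\<delta>t) (simp add: defect_\<delta>_def)
  moreover have "ext1 \<phi> \<circ> ext1 (fps_const R) = ext1 Rt \<circ> ext1 \<phi>"
    using zero(3) by (intro intertwine linear_additive[OF rb_linear] additive_Rt) (simp add: defect_R_def)
  ultimately show ?thesis
    by (auto simp: equivalent_deformations_def Let_def)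
qed

end
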